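(* Let $p=\min(m,n)$, fix $\omega\in(\mathbb{C}^* )^p$, and let $\mathrm{GT}_n^{\le m}(\omega)$ be the subvariety of $\mathrm{GT}_n^{\le m}$ consisting of patterns of shape $\omega$. The action of the geometric crystal operators $\bar e_1^c,\dots,\bar e_{n-1}^c$ ($c\in\mathbb{C}^*$) on $\mathrm{GT}_n^{\le m}(\omega)$ has a dense orbit.
   Context: $\mathrm{GT}_n^{\le m}$ is the torus of arrays $\mathbf{z}=(z_{i,j})$, $z_{i,j}\in\mathbb{C}^*$, $1\le i\le m$, $i\le j\le n$; the shape is $\mathrm{sh}(\mathbf{z})=(z_{1,n},\dots,z_{p,n})$. $E_{a,b}$ denotes a matrix unit, $x_j(a)=I+aE_{j,j+1}$, and for an $n\times n$ matrix $A$ and $I\subseteq[n]$, $\Delta_I(A)$ is the minor with rows $I$ and columns $[1,|I|]$ ($\Delta_\emptyset=1$). Let $W^i(y_i,\dots,y_n)=\sum_{k<i}E_{kk}+\sum_{k\ge i}y_kE_{kk}+\sum_{k=i}^{n-1}E_{k+1,k}$, $\Phi(\mathbf{z})=W^p(z_{p,p},\frac{z_{p,p+1}}{z_{p,p}},\dots,\frac{z_{p,n}}{z_{p,n-1}})\cdots W^1(z_{1,1},\frac{z_{1,2}}{z_{1,1}},\dots,\frac{z_{1,n}}{z_{1,n-1}})$, and $\Psi(A)=(\Delta_{[i,j]}(A)/\Delta_{[i+1,j]}(A))_{1\le i\le m,\,i\le j\le n}$. With $A=\Phi(\mathbf{z})$, set $\bar\varepsilon_j(\mathbf{z})=A_{j+1,j+1}/A_{j+1,j}$,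 $\bar\varphi_j(\mathbf{z})=A_{j,j}/A_{j+1,j}$, and $\bar e_j^c(\mathbf{z})=\Psi\big(x_j((c-1)\bar\varphi_j(\mathbf{z}))\,A\,x_j((c^{-1}-1)\bar\varepsilon_j(\mathbf{z}))\big)$, a rational action of $\mathbb{C}^*$ on $\mathrm{GT}_n^{\le m}$ preserving shape. An orbit is the set of points obtained from one point by repeatedly applying maps $\bar e_j^c$ (with $j\in[n-1]$, $c\in\mathbb{C}^*$, where defined); dense means Zariski dense in $\mathrm{GT}_n^{\le m}(\omega)$. *)

theory Defs
  imports "Jordan_Normal_Form.Determinant"
begin

text \<open>Arrays z = (z i j) are functions nat => nat => complex, 1-based,
  with z i j = 0 outside the index set 1 <= i <= m, i <= j <= n.
  n x n matrices are Jordan_Normal_Form matrices (0-based internally);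
  ent A i j is the 1-based entry.\<close>

definition GT :: "nat \<Rightarrow> nat \<Rightarrow> (nat \<Rightarrow> nat \<Rightarrow> complex) set" where
  "GT m n = {z. (\<forall>i j. (1 \<le> i \<and> i \<le> m \<and> i \<le> j \<and> j \<le> n) \<longrightarrow> z i j \<noteq> 0)
                \<and> (\<forall>i j. \<not> (1 \<le> i \<and> i \<le> m \<and> i \<le> j \<and> j \<le> n) \<longrightarrow> z i j = 0)}"

definition GT_shape :: "nat \<Rightarrow> nat \<Rightarrow> (nat \<Rightarrow> complex) \<Rightarrow> (nat \<Rightarrow> nat \<Rightarrow> complex) set" where
  "GT_shape m n \<omega> = {z \<in> GT m n. \<forall>k \<in> {1..min m n}. z k n = \<omega> k}"

definition ent :: "complex mat \<Rightarrow> nat \<Rightarrow> nat \<Rightarrow> complex" where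
  "ent A i j = A $$ (i - 1, j - 1)"

definition Wmat :: "nat \<Rightarrow> nat \<Rightarrow> (nat \<Rightarrow> complex) \<Rightarrow> complex mat" where
  "Wmat n i y = mat n n (\<lambda>(a, b). let k = a + 1; l = b + 1 in
      if k = l then (if k < i then 1 else y k)
      else if k = l + 1 \<and> i \<le> l then 1 else 0)"

definition Wargs :: "(nat \<Rightarrow> nat \<Rightarrow> complex) \<Rightarrow> nat \<Rightarrow> nat \<Rightarrow> complex" where
  "Wargs z i k = (if k = i then z i i else z i k / z i (k - 1))"

fun Phi_aux :: "nat \<Rightarrow> (nat \<Rightarrow> nat \<Rightarrow> complex) \<Rightarrow> nat \<Rightarrow> complex mat" where
  "Phi_aux n z 0 = 1\<^sub>m n"
| "Phi_aux n z (Suc r) = Wmat n (Suc r) (Wargs z (Suc r)) * Phi_aux n z r"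

definition Phi :: "nat \<Rightarrow> nat \<Rightarrow> (nat \<Rightarrow> nat \<Rightarrow> complex) \<Rightarrow> complex mat" where
  "Phi m n z = Phi_aux n z (min m n)"

text \<open>Minor with rows I (1-based, increasing order) and columns 1..|I|; the empty minor is 1.\<close>
definition minor :: "complex mat \<Rightarrow> nat set \<Rightarrow> complex" where
  "minor A I = det (mat (card I) (card I)
       (\<lambda>(a, b). A $$ (sorted_list_of_set I ! a - 1, b)))"

definition Psi :: "nat \<Rightarrow> nat \<Rightarrow> complex mat \<Rightarrow> (nat \<Rightarrow> nat \<Rightarrow> complex)" where
  "Psi m n A = (\<lambda>i j. if 1 \<le> i \<and> i \<le> m \<and> i \<le> j \<and> j \<le> n
                       then minor A {i..j} / minor A {i+1..j} else 0)"

definition xmat :: "nat \<Rightarrow> nat \<Rightarrow> complex \<Rightarrow> complex mat" where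
  "xmat n j a = mat n n (\<lambda>(r, c). if r = c then 1 else if r + 1 = j \<and> c = j then a else 0)"

definition eps_bar :: "nat \<Rightarrow> nat \<Rightarrow> nat \<Rightarrow> (nat \<Rightarrow> nat \<Rightarrow> complex) \<Rightarrow> complex" where
  "eps_bar m n j z = (let A = Phi m n z in ent A (j+1) (j+1) / ent A (j+1) j)"

definition phi_bar :: "nat \<Rightarrow> nat \<Rightarrow> nat \<Rightarrow> (nat \<Rightarrow> nat \<Rightarrow> complex) \<Rightarrow> complex" where
  "phi_bar m n j z = (let A = Phi m n z in ent A j j / ent A (j+1) j)"

definition e_mat :: "nat \<Rightarrow> nat \<Rightarrow> nat \<Rightarrow> complex \<Rightarrow> (nat \<Rightarrow> nat \<Rightarrow> complex) \<Rightarrow> complex mat" where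
  "e_mat m n j c z = xmat n j ((c - 1) * phi_bar m n j z) * Phi m n z
                     * xmat n j ((inverse c - 1) * eps_bar m n j z)"

definition e_bar :: "nat \<Rightarrow> nat \<Rightarrow> nat \<Rightarrow> complex \<Rightarrow> (nat \<Rightarrow> nat \<Rightarrow> complex) \<Rightarrow> (nat \<Rightarrow> nat \<Rightarrow> complex)" where
  "e_bar m n j c z = Psi m n (e_mat m n j c z)"

text \<open>e_bar j c is defined at z when all denominators in its defining formula
  are nonzero and the result is a point of the torus GT.\<close>
definition e_defined :: "nat \<Rightarrow> nat \<Rightarrow> nat \<Rightarrow> complex \<Rightarrow> (nat \<Rightarrow> nat \<Rightarrow> complex) \<Rightarrow> bool" where
  "e_defined m n j c z \<longleftrightarrow>
     ent (Phi m n z) (j+1) j \<noteq> 0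
     \<and> (\<forall>i j'. 1 \<le> i \<and> i \<le> m \<and> i \<le> j' \<and> j' \<le> n \<longrightarrow> minor (e_mat m n j c z) {i+1..j'} \<noteq> 0)
     \<and> e_bar m n j c z \<in> GT m n"

definition e_step :: "nat \<Rightarrow> nat \<Rightarrow> (nat \<Rightarrow> nat \<Rightarrow> complex) \<Rightarrow> (nat \<Rightarrow> nat \<Rightarrow> complex) \<Rightarrow> bool" where
  "e_step m n z z' \<longleftrightarrow> (\<exists>j c. 1 \<le> j \<and> j \<le> n - 1 \<and> c \<noteq> 0 \<and> e_defined m n j c z \<and> z' = e_bar m n j c z)"

definition orbit :: "nat \<Rightarrow> nat \<Rightarrow> (nat \<Rightarrow> nat \<Rightarrow> complex) \<Rightarrow> (nat \<Rightarrow> nat \<Rightarrow> complex) set" where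
  "orbit m n z0 = {z. (e_step m n)\<^sup>*\<^sup>* z0 z}"

inductive_set poly_fun :: "((nat \<Rightarrow> nat \<Rightarrow> complex) \<Rightarrow> complex) set" where
  const: "(\<lambda>z. c) \<in> poly_fun"
| coord: "(\<lambda>z. z i j) \<in> poly_fun"
| add: "f \<in> poly_fun \<Longrightarrow> g \<in> poly_fun \<Longrightarrow> (\<lambda>z. f z + g z) \<in> poly_fun"
| mult: "f \<in> poly_fun \<Longrightarrow> g \<in> poly_fun \<Longrightarrow> (\<lambda>z. f z * g z) \<in> poly_fun"

definition zariski_dense_in :: "(nat \<Rightarrow> nat \<Rightarrow> complex) set \<Rightarrow> (nat \<Rightarrow> nat \<Rightarrow> complex) set \<Rightarrow> bool" where
  "zariski_dense_in S X \<longleftrightarrow> S \<subseteq> X \<and>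
     (\<forall>f \<in> poly_fun. (\<forall>z \<in> S. f z = 0) \<longrightarrow> (\<forall>z \<in> X. f z = 0))"

end

theory Submission
  imports Defs
begin

text \<open>Let \<open>U\<close> be the group of upper unitriangular matrices. The solid minors entering \<open>\<Psi>\<close> use
  leading columns, so \<open>z\<close> only depends on the coset \<open>\<Phi>(z)U\<close>, and on these cosets \<open>e\<^sub>j\<^sup>c\<close> is left
  multiplication by \<open>x\<^sub>j(a)\<close> with \<open>a = (c - 1)\<phi>\<^sub>j(z)\<close> essentially free. By Gaussian elimination all cosets
  of one shape lie in a single \<open>U\<close>-orbit, that of a monomial matrix determined by the shape. Given a
  target \<open>z\<close>, write \<open>\<Phi>(z)U = x\<^sub>j(a) x\<^sub>k(b) \<dots> \<Phi>(z0)U\<close> and replace the parameters by \<open>ta, tb, \<dots>\<close>.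
  The conditions that make every step of the resulting path a legitimate crystal operator are
  nonvanishing conditions on polynomials in \<open>t\<close> that hold at \<open>t = 0\<close>, hence at all but finitely many \<open>t\<close>.
  A polynomial vanishing on the orbit of \<open>z0\<close> thus vanishes along the path for generic \<open>t\<close>, and by
  continuity also at \<open>z\<close>, where \<open>t = 1\<close>.\<close>

subsection \<open>Solid minors and banded matrices\<close>

text \<open>Row indices are 0-based and come as a function, so that the solid minors and the one
  other kind, with rows \<open>skip_row j\<close>, share the lemmas on right multiplication and on
  polynomial dependence.\<close>

definition rmin :: "complex mat \<Rightarrow> (nat \<Rightarrow> nat) \<Rightarrow> nat \<Rightarrow> complex" where
  "rmin A \<rho> s = det (mat s s (\<lambda>(a, b). A $$ (\<rho> a, b)))"

abbreviation solid :: "complex mat \<Rightarrow> nat \<Rightarrow> nat \<Rightarrow> complex" where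
  "solid A r s \<equiv> rmin A ((+) r) s"

definition unitri :: "nat \<Rightarrow> complex mat \<Rightarrow> bool" where
  "unitri n V \<longleftrightarrow> V \<in> carrier_mat n n \<and> (\<forall>i<n. V $$ (i, i) = 1) \<and> (\<forall>i<n. \<forall>j<i. V $$ (i, j) = 0)"

lemma mult_entry:
  assumes "A \<in> carrier_mat n n" "B \<in> carrier_mat n n" "i < n" "j < n"
  shows "(A * B) $$ (i, j) = (\<Sum>l<n. A $$ (i, l) * B $$ (l, j))"
  using assms by (simp add: scalar_prod_def atLeast0LessThan)

lemma mat_mult_mat:
  fixes f g :: "nat \<times> nat \<Rightarrow> complex"
  shows "mat s s f * mat s s g = mat s s (\<lambda>(i, j). \<Sum>l<s. f (i, l) * g (l, j))"
  by (rule eq_matI) (auto simp: scalar_prod_def atLeast0LessThan)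

lemma minor_interval:
  assumes "1 \<le> i"
  shows "minor A {i..j} = solid A (i - 1) (j + 1 - i)"
proof -
  have "sorted_list_of_set {i..j} = [i..<Suc j]"
    by (metis atLeastLessThanSuc_atLeastAtMost sorted_list_of_set_range)
  then have "mat (card {i..j}) (card {i..j}) (\<lambda>(a, b). A $$ (sorted_list_of_set {i..j} ! a - 1, b))
      = mat (j + 1 - i) (j + 1 - i) (\<lambda>(a, b). A $$ (i - 1 + a, b))"
    using assms by (intro eq_matI) (auto simp del: upt_Suc)
  then show ?thesis by (simp add: minor_def rmin_def)
qed

lemma rmin_0 [simp]: "rmin A \<rho> 0 = 1"
  by (simp add: rmin_def)

lemma rmin_cong:
  assumes "\<And>a b. a < s \<Longrightarrow> b < s \<Longrightarrow> A $$ (\<rho> a, b) = B $$ (\<sigma> a, b)"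
  shows "rmin A \<rho> s = rmin B \<sigma> s"
proof -
  have "mat s s (\<lambda>(a, b). A $$ (\<rho> a, b)) = mat s s (\<lambda>(a, b). B $$ (\<sigma> a, b))"
    by (rule eq_matI) (use assms in auto)
  then show ?thesis by (simp add: rmin_def)
qed

lemma det_mat_lower:
  assumes "\<And>i j. i < j \<Longrightarrow> j < s \<Longrightarrow> f (i, j) = 0"
  shows "det (mat s s f) = (\<Prod>i<s. f (i, i))"
proof -
  have "det (mat s s f) = prod_list (diag_mat (mat s s f))"
    by (rule det_lower_triangular[of s]) (use assms in auto)
  then show ?thesis by (simp add: prod_list_diag_prod atLeast0LessThan)
qed

lemma det_mat_upper:
  assumes "\<And>i j. j < i \<Longrightarrow> i < s \<Longrightarrow> f (i, j) = 0"
  shows "det (mat s s f) = (\<Prod>i<s. f (i, i))"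
proof -
  have "det (mat s s f) = prod_list (diag_mat (mat s s f))"
    by (rule det_upper_triangular[of _ s]) (use assms in \<open>auto simp: upper_triangular_def\<close>)
  then show ?thesis by (simp add: prod_list_diag_prod atLeast0LessThan)
qed

text \<open>The first s columns of \<open>A * V\<close> combine only the first s columns of A,
  through the leading block of V, which has determinant 1. Hence these minors are functions of the
  coset A U.\<close>

lemma rmin_right_unitri:
  assumes A: "A \<in> carrier_mat n n" and V: "unitri n V" and s: "s \<le> n"
    and \<rho>: "\<And>a. a < s \<Longrightarrow> \<rho> a < n"
  shows "rmin (A * V) \<rho> s = rmin A \<rho> s"
proof -
  let ?S = "mat s s (\<lambda>(a, b). A $$ (\<rho> a, b))" and ?V = "mat s s (\<lambda>p. V $$ p)"
  have Vc: "V \<in> carrier_mat n n" using V by (simp add: unitri_def)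
  have "mat s s (\<lambda>(a, b). (A * V) $$ (\<rho> a, b)) = ?S * ?V"
  proof (subst mat_mult_mat, rule cong_mat[OF refl refl], clarsimp)
    fix i j assume ij: "i < s" "j < s"
    have "(A * V) $$ (\<rho> i, j) = (\<Sum>l<n. A $$ (\<rho> i, l) * V $$ (l, j))"
      using mult_entry[OF A Vc] \<rho> ij s by auto
    also have "\<dots> = (\<Sum>l<s. A $$ (\<rho> i, l) * V $$ (l, j))"
      by (rule sum.mono_neutral_right) (use s V ij in \<open>auto simp: unitri_def\<close>)
    finally show "(A * V) $$ (\<rho> i, j) = (\<Sum>l<s. A $$ (\<rho> i, l) * V $$ (l, j))" .
  qed
  then have "rmin (A * V) \<rho> s = det ?S * det ?V"
    unfolding rmin_def by (metis det_mult mat_carrier)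
  also have "det ?V = 1"
    using V s by (subst det_mat_upper) (auto simp: unitri_def)
  finally show ?thesis by (simp add: rmin_def)
qed

text \<open>By \<open>z\<close> the rows of L involved are supported on columns with the same
  indices, which leaves a single term of the Cauchy-Binet expansion. This serves for the factors
  \<open>Wmat\<close> of \<open>Phi\<close> and for \<open>xmat\<close> acting on the bottom
  rows.\<close>

lemma solid_left:
  assumes L: "L \<in> carrier_mat n n" and A: "A \<in> carrier_mat n n" and rs: "r + s \<le> n"
    and z: "\<And>k l. r \<le> k \<Longrightarrow> k < r + s \<Longrightarrow> l < n \<Longrightarrow> l < r \<or> r + s \<le> l \<Longrightarrow> L $$ (k, l) = 0"
  shows "solid (L * A) r s = det (mat s s (\<lambda>(a, b). L $$ (r + a, r + b))) * solid A r s"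
proof -
  let ?S = "mat s s (\<lambda>(a, b). A $$ (r + a, b))" and ?L = "mat s s (\<lambda>(a, b). L $$ (r + a, r + b))"
  have "mat s s (\<lambda>(a, b). (L * A) $$ (r + a, b)) = ?L * ?S"
  proof (subst mat_mult_mat, rule cong_mat[OF refl refl], clarsimp)
    fix i j assume ij: "i < s" "j < s"
    have "(L * A) $$ (r + i, j) = (\<Sum>l<n. L $$ (r + i, l) * A $$ (l, j))"
      using mult_entry[OF L A] ij rs by auto
    also have "\<dots> = (\<Sum>l\<in>{0+r..<s+r}. L $$ (r + i, l) * A $$ (l, j))"
      by (rule sum.mono_neutral_right) (use rs ij in \<open>auto intro!: z simp: not_less\<close>)
    also have "\<dots> = (\<Sum>l<s. L $$ (r + i, r + l) * A $$ (r + l, j))"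
      by (subst sum.shift_bounds_nat_ivl) (simp add: atLeast0LessThan add.commute)
    finally show "(L * A) $$ (r + i, j) = (\<Sum>l<s. L $$ (r + i, r + l) * A $$ (r + l, j))" .
  qed
  then show ?thesis
    unfolding rmin_def by (metis det_mult mat_carrier)
qed

text \<open>The form of \<open>Phi m n z\<close> for p = \<open>min m n\<close>. Conversely, by
  \<open>Psi_banded\<close>, such a matrix with nonvanishing solid minors lies in the image of
  \<open>Phi\<close>.\<close>

definition banded :: "nat \<Rightarrow> nat \<Rightarrow> complex mat \<Rightarrow> bool" where
  "banded n p B \<longleftrightarrow> B \<in> carrier_mat n n \<and>
     (\<forall>k<n. \<forall>l<n. (k < l \<or> l + p < k \<longrightarrow> B $$ (k, l) = 0) \<and> (k = l + p \<longrightarrow> B $$ (k, l) = 1))"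

lemma banded_carrier: "banded n p B \<Longrightarrow> B \<in> carrier_mat n n"
  by (simp add: banded_def)

lemma banded_upper: "banded n p B \<Longrightarrow> k < l \<Longrightarrow> l < n \<Longrightarrow> B $$ (k, l) = 0"
  by (simp add: banded_def)

lemma banded_below: "banded n p B \<Longrightarrow> l + p < k \<Longrightarrow> k < n \<Longrightarrow> B $$ (k, l) = 0"
  by (simp add: banded_def)

lemma banded_one: "banded n p B \<Longrightarrow> k = l + p \<Longrightarrow> k < n \<Longrightarrow> B $$ (k, l) = 1"
  unfolding banded_def by (metis le_add1 order.strict_trans1)

lemma banded_solid_1:
  assumes "banded n p B" "p + s \<le> n"
  shows "solid B p s = 1"
  unfolding rmin_def using assms
  by (subst det_mat_upper) (auto simp: banded_below banded_one intro!: prod.neutral)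

text \<open>Expanding along the last row expresses the bottom right entry of each solid minor through the
  smaller entries, since its cofactor is again a nonvanishing solid minor.\<close>

lemma banded_eqI:
  assumes B: "banded n p B" and C: "banded n p C"
    and eq: "\<And>r s. r < p \<Longrightarrow> 1 \<le> s \<Longrightarrow> r + s \<le> n \<Longrightarrow> solid B r s = solid C r s"
    and nz: "\<And>r s. r < p \<Longrightarrow> 1 \<le> s \<Longrightarrow> r + s \<le> n \<Longrightarrow> solid B r s \<noteq> 0"
  shows "B = C"
proof -
  have "B $$ (k, l) = C $$ (k, l)" if "k < n" "l < n" for k l
    using that
  \<comment> \<open>Within the solid minor whose bottom right corner is (k, l), the corner has the
    largest index sum, so the hypothesis covers all its other entries.\<close>
  proof (induction "k + l" arbitrary: k l rule: less_induct)
    case less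
    consider "k < l \<or> l + p \<le> k" | "l \<le> k" "k < l + p" by linarith
    then show ?case
    proof cases
      case 1 then show ?thesis
        using B C less.prems unfolding banded_def by (metis le_neq_implies_less)
    next
      case 2
      define r where "r = k - l"
      have k: "k = r + l" and rp: "r < p" using 2 by (auto simp: r_def)
      let ?M = "\<lambda>B. mat (Suc l) (Suc l) (\<lambda>(a, b). B $$ (r + a, b) :: complex)"
      have exp: "solid B r (Suc l) = (\<Sum>b<l. B $$ (k, b) * cofactor (?M B) l b) + B $$ (k, l) * solid B r l"
        for B
      proof -
        have "det (?M B) = (\<Sum>b<Suc l. ?M B $$ (l, b) * cofactor (?M B) l b)"
          by (rule laplace_expansion_row) auto
        also have "\<dots> = (\<Sum>b<l. B $$ (k, b) * cofactor (?M B) l b) + B $$ (k, l) * cofactor (?M B) l l"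
          by (simp add: k)
        also have "cofactor (?M B) l l = solid B r l"
        proof -
          have "mat_delete (?M B) l l = mat l l (\<lambda>(a, b). B $$ (r + a, b))"
            by (rule eq_matI) (auto simp: mat_delete_def)
          then show ?thesis by (simp add: cofactor_def rmin_def)
        qed
        finally show ?thesis by (simp add: rmin_def)
      qed
      have lo: "B $$ (r + a, b) = C $$ (r + a, b)" if "a \<le> l" "b \<le> l" "a < l \<or> b < l" for a b
        using less.hyps[of "r + a" b] less.prems that by (auto simp: k)
      have cof: "cofactor (?M B) l b = cofactor (?M C) l b" if "b < l" for b
      proof -
        have "mat_delete (?M B) l b = mat_delete (?M C) l b"
          by (rule eq_matI) (auto simp: mat_delete_def that intro!: lo)
        then show ?thesis by (simp add: cofactor_def)
      qed
      have s: "solid B r l = solid C r l" by (rule rmin_cong) (auto intro!: lo)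
      have "solid B r (Suc l) = solid C r (Suc l)"
        using eq[of r "Suc l"] rp less.prems by (auto simp: k)
      then have "B $$ (k, l) * solid B r l = C $$ (k, l) * solid C r l"
        unfolding exp using lo cof by (simp add: k)
      moreover have "solid B r l \<noteq> 0"
        using nz[of r l] rp less.prems by (cases "l = 0") (auto simp: k)
      ultimately show ?thesis using s by simp
    qed
  qed
  then show ?thesis using B C by (intro eq_matI) (auto simp: banded_def)
qed

subsection \<open>Minors of \<open>\<Phi>(z)\<close> and inversion of \<open>\<Phi>\<close>\<close>

lemma Wmat_carrier [simp]: "Wmat n i y \<in> carrier_mat n n"
  by (simp add: Wmat_def)

lemma Wmat_entry:
  assumes "a < n" "b < n"
  shows "Wmat n i y $$ (a, b) =
    (if a = b then (if a + 1 < i then 1 else y (a + 1)) else if a = b + 1 \<and> i \<le> a then 1 else 0)"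
  using assms by (simp add: Wmat_def Let_def)

lemma Phi_aux_carrier [simp]: "Phi_aux n z r \<in> carrier_mat n n"
  by (induction r) (auto intro: mult_carrier_mat[OF Wmat_carrier])

lemma Phi_carrier [simp]: "Phi m n z \<in> carrier_mat n n"
  by (simp add: Phi_def)

lemma Wmat_mult_entry:
  assumes M: "M \<in> carrier_mat n n" and "k < n" "l < n"
  shows "(Wmat n (Suc r) y * M) $$ (k, l) =
    (if k < r then 1 else y (k + 1)) * M $$ (k, l) + (if Suc r \<le> k then M $$ (k - 1, l) else 0)"
proof -
  have "(Wmat n (Suc r) y * M) $$ (k, l) = (\<Sum>i<n. Wmat n (Suc r) y $$ (k, i) * M $$ (i, l))"
    using assms by (simp add: mult_entry)
  also have "\<dots> = (\<Sum>i<n. (if i = k then (if k < r then 1 else y (k + 1)) * M $$ (k, l) else 0)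
      + (if i = k - 1 then (if Suc r \<le> k then M $$ (k - 1, l) else 0) else 0))"
    by (rule sum.cong) (use assms in \<open>auto simp: Wmat_entry\<close>)
  also have "\<dots> = (if k < r then 1 else y (k + 1)) * M $$ (k, l) + (if Suc r \<le> k then M $$ (k - 1, l) else 0)"
    using assms by (auto simp: sum.distrib sum.delta)
  finally show ?thesis .
qed

text \<open>Each factor \<open>Wmat\<close> adds a shifted copy of the rows, which lengthens the
  band by one subdiagonal and carries the lowest ones along.\<close>

lemma banded_Phi_aux: "banded n r (Phi_aux n z r)"
proof (induction r)
  case 0
  show ?case by (auto simp: banded_def)
next
  case (Suc r)
  have "(Phi_aux n z (Suc r)) $$ (k, l) = 0" if "k < l \<or> l + Suc r < k" "k < n" "l < n" for k l
    using that Suc by (auto simp: Wmat_mult_entry banded_upper banded_below)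
  moreover have "(Phi_aux n z (Suc r)) $$ (l + Suc r, l) = 1" if "l + Suc r < n" for l
    using that Suc by (auto simp: Wmat_mult_entry banded_one banded_below)
  ultimately show ?case
    by (auto simp: banded_def simp del: Phi_aux.simps)
qed

lemma banded_Phi: "banded n (min m n) (Phi m n z)"
  by (simp add: Phi_def banded_Phi_aux)

lemma GT_nonzero: "z \<in> GT m n \<Longrightarrow> 1 \<le> i \<Longrightarrow> i \<le> m \<Longrightarrow> i \<le> j \<Longrightarrow> j \<le> n \<Longrightarrow> z i j \<noteq> 0"
  by (simp add: GT_def)

text \<open>The quotients in row \<open>Suc r\<close> of z telescope, starting from the plain entry
  in column \<open>Suc r\<close>; the diagonal entries before it are 1.\<close>

lemma prod_Wargs:
  assumes z: "z \<in> GT m n" and "r < m" "q \<le> r" "q + s \<le> n"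
  shows "(\<Prod>a<s. if q + a < r then 1 else Wargs z (Suc r) (q + a + 1))
    = (if r < q + s then z (Suc r) (q + s) else 1)"
  using assms(4)
proof (induction s)
  case 0
  then show ?case using assms by auto
next
  case (Suc s)
  have "z (Suc r) (q + s) \<noteq> 0" if "r < q + s"
    using that Suc.prems assms by (intro GT_nonzero[OF z]) auto
  with Suc show ?case by (auto simp: Wargs_def not_less)
qed

text \<open>The induction starts at r = q, where the minor runs along the band of ones. In every
  later factor the row q has no subdiagonal entry, so \<open>solid_left\<close> applies and
  contributes the product of the diagonal entries.\<close>

lemma solid_Phi_aux:
  assumes z: "z \<in> GT m n" and "q \<le> r" "r \<le> m" and qs: "q + s \<le> n"
  shows "solid (Phi_aux n z r) q s = (\<Prod>i\<in>{q<..min r (q + s)}. z i (q + s))"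
  using assms(2,3)
proof (induction r rule: dec_induct)
  case base
  then show ?case using banded_solid_1[OF banded_Phi_aux qs] by simp
next
  case (step r)
  have "solid (Phi_aux n z (Suc r)) q s =
      det (mat s s (\<lambda>(a, b). Wmat n (Suc r) (Wargs z (Suc r)) $$ (q + a, q + b))) * solid (Phi_aux n z r) q s"
    unfolding Phi_aux.simps
    by (rule solid_left[of _ n]) (use qs step in \<open>auto simp: Wmat_entry\<close>)
  also have "det (mat s s (\<lambda>(a, b). Wmat n (Suc r) (Wargs z (Suc r)) $$ (q + a, q + b)))
      = (\<Prod>a<s. if q + a < r then 1 else Wargs z (Suc r) (q + a + 1))"
    by (subst det_mat_lower) (use qs in \<open>auto simp: Wmat_entry intro!: prod.cong\<close>)
  also have "\<dots> = (if r < q + s then z (Suc r) (q + s) else 1)"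
    by (rule prod_Wargs[OF z]) (use step qs in auto)
  finally have eq: "solid (Phi_aux n z (Suc r)) q s =
      (if r < q + s then z (Suc r) (q + s) else 1) * (\<Prod>i\<in>{q<..min r (q + s)}. z i (q + s))"
    using step by simp
  show ?case
  proof (cases "r < q + s")
    case True
    then have "{q<..min (Suc r) (q + s)} = insert (Suc r) {q<..min r (q + s)}"
      using step by auto
    then show ?thesis using eq True by simp
  next
    case False
    then show ?thesis using eq by (simp add: min_def)
  qed
qed

lemma solid_Phi:
  assumes "z \<in> GT m n" "q \<le> min m n" "q + s \<le> n"
  shows "solid (Phi m n z) q s = (\<Prod>i\<in>{q<..min (min m n) (q + s)}. z i (q + s))"
  unfolding Phi_def by (rule solid_Phi_aux[OF assms(1)]) (use assms in auto)

lemma solid_Phi_nonzero: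
  assumes "z \<in> GT m n" "q \<le> min m n" "q + s \<le> n"
  shows "solid (Phi m n z) q s \<noteq> 0"
  unfolding solid_Phi[OF assms] using assms GT_nonzero[OF assms(1)] by auto

lemma Psi_solid:
  assumes "1 \<le> i" "i \<le> m" "i \<le> j" "j \<le> n"
  shows "Psi m n A i j = solid A (i - 1) (j + 1 - i) / solid A i (j - i)"
  using assms by (simp add: Psi_def minor_interval)

text \<open>The products for two solid minors with the same last row j and first rows i and i + 1
  differ by the factor \<open>z i j\<close> alone.\<close>

lemma Psi_Phi:
  assumes z: "z \<in> GT m n"
  shows "Psi m n (Phi m n z) = z"
proof (intro ext)
  fix i j
  show "Psi m n (Phi m n z) i j = z i j"
  proof (cases "1 \<le> i \<and> i \<le> m \<and> i \<le> j \<and> j \<le> n")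
    case True
    then have "{i - 1<..min (min m n) j} = insert i {i<..min (min m n) j}" "i - 1 \<le> min m n" by auto
    then have "solid (Phi m n z) (i - 1) (j + 1 - i) = z i j * solid (Phi m n z) i (j - i)"
      using True solid_Phi[OF z, of "i - 1" "j + 1 - i"] solid_Phi[OF z, of i "j - i"] by simp
    moreover have "solid (Phi m n z) i (j - i) \<noteq> 0"
      by (rule solid_Phi_nonzero[OF z]) (use True in auto)
    ultimately show ?thesis using True by (simp add: Psi_solid)
  next
    case False
    then show ?thesis using z by (auto simp: Psi_def GT_def)
  qed
qed

lemma prod_quotients_telescope:
  fixes f :: "nat \<Rightarrow> complex"
  assumes "q \<le> M" and "\<And>i. q \<le> i \<Longrightarrow> i \<le> M \<Longrightarrow> f i \<noteq> 0"
  shows "(\<Prod>i\<in>{q<..M}. f (i - 1) / f i) = f q / f M"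
  using assms
proof (induction M rule: dec_induct)
  case (step M)
  have "{q<..Suc M} = insert (Suc M) {q<..M}" using step.hyps by auto
  then show ?case using step.IH step.prems step.hyps by simp
qed simp

text \<open>The product formula for the solid minors of \<open>Phi m n (Psi m n B)\<close>
  telescopes back to those of B, and \<open>banded_eqI\<close> recovers the matrix.\<close>

lemma Psi_banded:
  assumes B: "banded n (min m n) B"
    and nz: "\<And>q s. q < min m n \<Longrightarrow> q + s \<le> n \<Longrightarrow> solid B q s \<noteq> 0"
  shows "Psi m n B \<in> GT m n" and "Phi m n (Psi m n B) = B"
proof -
  \<comment> \<open>The boundary case q = \<open>min m n\<close> comes from the band of
    ones.\<close>
  have nz': "solid B q s \<noteq> 0" if "q \<le> min m n" "q + s \<le> n" for q s
    using that nz[of q s] banded_solid_1[OF B, of s] by (cases "q = min m n") (simp_all add: le_neq_implies_less)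
  show GT: "Psi m n B \<in> GT m n"
    using nz' by (auto simp: GT_def Psi_solid) (auto simp: Psi_def)
  have "solid B q s = solid (Phi m n (Psi m n B)) q s" if "q < min m n" "q + s \<le> n" for q s
  proof -
    let ?M = "min (min m n) (q + s)" and ?f = "\<lambda>i. solid B i (q + s - i)"
    have "solid (Phi m n (Psi m n B)) q s = (\<Prod>i\<in>{q<..?M}. Psi m n B i (q + s))"
      using solid_Phi[OF GT] that by simp
    also have "\<dots> = (\<Prod>i\<in>{q<..?M}. ?f (i - 1) / ?f i)"
      by (rule prod.cong) (use that in \<open>auto simp: Psi_solid Suc_diff_le\<close>)
    also have "\<dots> = ?f q / ?f ?M"
      by (rule prod_quotients_telescope) (use that nz' in auto)
    \<comment> \<open>Either \<open>?M\<close> is q + s and the minor is empty, or it is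
      \<open>min m n\<close> and the minor runs along the band of ones.\<close>
    also have "?f ?M = 1"
      using that banded_solid_1[OF B, of "q + s - min m n"] by (cases "q + s \<le> min m n") auto
    finally show ?thesis by simp
  qed
  then show "Phi m n (Psi m n B) = B"
    by (intro sym[OF banded_eqI[OF B banded_Phi]]) (use nz in auto)
qed

subsection \<open>Crystal operators as left multiplications\<close>

lemma xmat_carrier [simp]: "xmat n j a \<in> carrier_mat n n"
  by (simp add: xmat_def)

lemma xmat_entry:
  "r < n \<Longrightarrow> c < n \<Longrightarrow> xmat n j a $$ (r, c) = (if r = c then 1 else if r + 1 = j \<and> c = j then a else 0)"
  by (simp add: xmat_def)

lemma xmat_mult_entry:
  assumes "M \<in> carrier_mat n n" "1 \<le> j" "j < n" "k < n" "l < n"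
  shows "(xmat n j a * M) $$ (k, l) = M $$ (k, l) + (if k + 1 = j then a * M $$ (j, l) else 0)"
proof -
  have "(xmat n j a * M) $$ (k, l) = (\<Sum>i<n. xmat n j a $$ (k, i) * M $$ (i, l))"
    using assms by (simp add: mult_entry)
  also have "\<dots> = (\<Sum>i<n. (if i = k then M $$ (k, l) else 0)
      + (if i = j then (if k + 1 = j then a * M $$ (j, l) else 0) else 0))"
    by (rule sum.cong) (use assms in \<open>auto simp: xmat_entry\<close>)
  finally show ?thesis using assms by (auto simp: sum.distrib sum.delta)
qed

lemma mult_xmat_entry:
  assumes "M \<in> carrier_mat n n" "1 \<le> j" "j < n" "k < n" "l < n"
  shows "(M * xmat n j a) $$ (k, l) = M $$ (k, l) + (if l = j then a * M $$ (k, j - 1) else 0)"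
proof -
  have "(M * xmat n j a) $$ (k, l) = (\<Sum>i<n. M $$ (k, i) * xmat n j a $$ (i, l))"
    using assms by (simp add: mult_entry)
  also have "\<dots> = (\<Sum>i<n. (if i = l then M $$ (k, l) else 0)
      + (if i = j - 1 then (if l = j then a * M $$ (k, j - 1) else 0) else 0))"
    by (rule sum.cong) (use assms in \<open>auto simp: xmat_entry\<close>)
  finally show ?thesis using assms by (auto simp: sum.distrib sum.delta)
qed

lemma xmat_0 [simp]: "xmat n j 0 = 1\<^sub>m n"
  by (rule eq_matI) (auto simp: xmat_def)

lemma xmat_mult_inverse:
  assumes "1 \<le> j" "j < n"
  shows "xmat n j a * xmat n j (- a) = 1\<^sub>m n"
proof (rule eq_matI)
  show "(xmat n j a * xmat n j (- a)) $$ (k, l) = 1\<^sub>m n $$ (k, l)"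
    if "k < dim_row (1\<^sub>m n)" "l < dim_col (1\<^sub>m n)" for k l
    using that assms by (auto simp: xmat_mult_entry xmat_entry simp del: index_mult_mat(1))
qed (simp_all add: xmat_def)

lemma unitri_xmat: "1 \<le> j \<Longrightarrow> unitri n (xmat n j a)"
  by (auto simp: unitri_def xmat_entry)

lemma unitri_carrier: "unitri n V \<Longrightarrow> V \<in> carrier_mat n n"
  by (simp add: unitri_def)

lemma unitri_mult:
  assumes U: "unitri n U" and V: "unitri n V"
  shows "unitri n (U * V)"
proof -
  have c: "U \<in> carrier_mat n n" "V \<in> carrier_mat n n"
    using U V by (auto simp: unitri_carrier)
  have "(U * V) $$ (i, i) = 1" if "i < n" for i
  proof -
    have "(U * V) $$ (i, i) = (\<Sum>l<n. if l = i then 1 else 0)"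
      unfolding mult_entry[OF c that that]
      by (rule sum.cong) (use U V that in \<open>auto simp: unitri_def linorder_neq_iff\<close>)
    then show ?thesis using that by simp
  qed
  moreover have "(U * V) $$ (i, j) = 0" if "i < n" "j < i" for i j
  proof -
    have "U $$ (i, l) * V $$ (l, j) = 0" if "l < n" for l
      using U V that \<open>i < n\<close> \<open>j < i\<close> by (cases "l < i") (auto simp: unitri_def)
    then show ?thesis using that mult_entry[OF c \<open>i < n\<close>, of j] by (auto intro: sum.neutral)
  qed
  ultimately show ?thesis using c by (simp add: unitri_def)
qed

section \<open>Coset representatives and single crystal steps\<close>

definition nondeg :: "nat \<Rightarrow> nat \<Rightarrow> complex mat \<Rightarrow> bool" where
  "nondeg m n F \<longleftrightarrow> (\<forall>q s. q < min m n \<longrightarrow> q + s \<le> n \<longrightarrow> solid F q s \<noteq> 0)"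

text \<open>F is an arbitrary representative of the coset of \<open>Phi m n z\<close>: left
  multiplication by \<open>xmat\<close> leaves the image of \<open>Phi\<close>, and only the coset
  matters for \<open>Psi\<close>.\<close>

definition rep :: "nat \<Rightarrow> nat \<Rightarrow> (nat \<Rightarrow> nat \<Rightarrow> complex) \<Rightarrow> complex mat \<Rightarrow> bool" where
  "rep m n z F \<longleftrightarrow> z \<in> GT m n \<and> (\<exists>V. unitri n V \<and> F = Phi m n z * V)"

lemma rep_carrier: "rep m n z F \<Longrightarrow> F \<in> carrier_mat n n"
  by (auto simp: rep_def unitri_def intro: mult_carrier_mat[OF Phi_carrier])

lemma rep_rmin:
  assumes "rep m n z F" "s \<le> n" "\<And>a. a < s \<Longrightarrow> \<rho> a < n"
  shows "rmin F \<rho> s = rmin (Phi m n z) \<rho> s"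
  using assms unfolding rep_def by (auto intro!: rmin_right_unitri[OF Phi_carrier])

lemma Psi_cong_solid:
  assumes "\<And>q s. q + s \<le> n \<Longrightarrow> solid A q s = solid B q s"
  shows "Psi m n A = Psi m n B"
proof (intro ext)
  fix i j
  show "Psi m n A i j = Psi m n B i j"
    using assms[of "i - 1" "j + 1 - i"] assms[of i "j - i"]
    by (cases "1 \<le> i \<and> i \<le> m \<and> i \<le> j \<and> j \<le> n") (auto simp: Psi_solid, auto simp: Psi_def)
qed

lemma rep_Psi:
  assumes "rep m n z F"
  shows "Psi m n F = z"
proof -
  have "Psi m n F = Psi m n (Phi m n z)"
    by (rule Psi_cong_solid) (use assms in \<open>auto intro!: rep_rmin\<close>)
  then show ?thesis using assms by (simp add: rep_def Psi_Phi)
qed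

text \<open>The minor with these rows detects the subdiagonal entry \<open>A\<^sub>j\<^sub>+\<^sub>1\<^sub>,\<^sub>j\<close> of a lower triangular matrix in a way
  that only depends on its \<open>U\<close>-coset.\<close>

definition skip_row :: "nat \<Rightarrow> nat \<Rightarrow> nat" where
  "skip_row j a = (if a + 1 = j then j else a)"

lemma rmin_skip_row_banded:
  assumes A: "banded n p A" and j: "1 \<le> j" "j < n"
  shows "rmin A (skip_row j) j = (\<Prod>i<j - 1. A $$ (i, i)) * A $$ (j, j - 1)"
proof -
  obtain i where i: "j = Suc i" using j by (cases j) auto
  have "rmin A (skip_row j) j = (\<Prod>a<j. A $$ (skip_row j a, a))"
    unfolding rmin_def
    by (subst det_mat_lower) (use j in \<open>auto simp: skip_row_def intro!: banded_upper[OF A]\<close>)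
  also have "\<dots> = (\<Prod>a<i. A $$ (skip_row j a, a)) * A $$ (skip_row j i, i)"
    by (simp add: i)
  also have "(\<Prod>a<i. A $$ (skip_row j a, a)) = (\<Prod>a<i. A $$ (a, a))"
    by (rule prod.cong) (auto simp: skip_row_def i)
  finally show ?thesis by (simp add: i skip_row_def[of "Suc i" i])
qed

lemma banded_solid_0:
  assumes A: "banded n p A" and s: "s \<le> n"
  shows "solid A 0 s = (\<Prod>i<s. A $$ (i, i))"
  unfolding rmin_def by (subst det_mat_lower) (use s in \<open>auto intro!: banded_upper[OF A]\<close>)

text \<open>Lower triangularity can fail only at the entry (j - 1, j), whose value is the left side
  of \<open>z\<close>. The entries added on or below the lowest band diagonal come from below the
  band of A and vanish.\<close>

lemma banded_crystal_conj:
  assumes A: "banded n p A" and j: "1 \<le> j" "j < n"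
    and z: "A $$ (j - 1, j - 1) * b + a * A $$ (j, j - 1) * b + a * A $$ (j, j) = 0"
  shows "banded n p (xmat n j a * A * xmat n j b)"
proof -
  note Ac = banded_carrier[OF A]
  have Xc: "xmat n j a * A \<in> carrier_mat n n" using Ac by (intro mult_carrier_mat[OF xmat_carrier])
  have e: "(xmat n j a * A * xmat n j b) $$ (k, l) =
      (A $$ (k, l) + (if k + 1 = j then a * A $$ (j, l) else 0)) +
      (if l = j then b * (A $$ (k, j - 1) + (if k + 1 = j then a * A $$ (j, j - 1) else 0)) else 0)"
    if "k < n" "l < n" for k l
    using that j by (simp add: mult_xmat_entry[OF Xc] xmat_mult_entry[OF Ac] del: index_mult_mat(1))
  have "(xmat n j a * A * xmat n j b) $$ (k, l) = 0" if "k < l" "k < n" "l < n" for k l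
  proof (cases "k + 1 = j \<and> l = j")
    case True
    then show ?thesis using z that j banded_upper[OF A, of k l] by (auto simp: e algebra_simps)
  next
    case False
    then show ?thesis using that j banded_upper[OF A] by (auto simp: e)
  qed
  moreover have "(xmat n j a * A * xmat n j b) $$ (k, l) = 0" if "l + p < k" "k < n" "l < n" for k l
    using that j banded_below[OF A] by (auto simp: e)
  moreover have "(xmat n j a * A * xmat n j b) $$ (l + p, l) = 1" if "l + p < n" for l
    using that j banded_below[OF A, of l j] banded_below[OF A, of "j - 1" "j + p"] banded_below[OF A, of "j - 1" j]
      banded_one[OF A, of _ l]
    by (auto simp: e)
  ultimately show ?thesis
    using mult_carrier_mat[OF Xc xmat_carrier[of n j b]] unfolding banded_def by blast
qed

lemma banded_nondeg:
  assumes "banded n (min m n) B" "nondeg m n B" "q \<le> min m n" "q + s \<le> n"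
  shows "solid B q s \<noteq> 0"
  using assms banded_solid_1[OF assms(1), of s]
  by (cases "q = min m n") (simp_all add: nondeg_def le_neq_implies_less)

text \<open>A suitable c turns the left factor of \<open>e_mat\<close> into
  \<open>xmat n j a\<close>; the right factor lies in U and restores the band. The new matrix is
  therefore in the image of \<open>Phi\<close> and in the coset of
  \<open>xmat n j a * F\<close>.\<close>

lemma crystal_step:
  assumes m: "1 \<le> m" and F: "rep m n z F" and j: "1 \<le> j" "j < n"
    and nz: "rmin F (skip_row j) j \<noteq> 0" and nd: "nondeg m n (xmat n j a * F)"
  shows "\<exists>z'. e_step m n z z' \<and> rep m n z' (xmat n j a * F)"
proof -
  define A where "A = Phi m n z"
  obtain V where V: "unitri n V" "F = A * V" and z: "z \<in> GT m n"
    using F by (auto simp: rep_def A_def)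
  have A: "banded n (min m n) A" by (simp add: A_def banded_Phi)
  note Ac = banded_carrier[OF A] and Vc = unitri_carrier[OF V(1)]
  have Xc: "xmat n j a * A \<in> carrier_mat n n" using Ac by (intro mult_carrier_mat[OF xmat_carrier])
  have XF: "xmat n j a * F = xmat n j a * A * V"
    unfolding V by (rule assoc_mult_mat[symmetric, OF xmat_carrier Ac Vc])
  have sub: "A $$ (j, j - 1) \<noteq> 0"
  proof -
    have "rmin F (skip_row j) j = rmin A (skip_row j) j"
      unfolding A_def by (rule rep_rmin[OF F]) (use j in \<open>auto simp: skip_row_def\<close>)
    then show ?thesis using nz rmin_skip_row_banded[OF A j] by auto
  qed
  have diag: "A $$ (j - 1, j - 1) \<noteq> 0"
  proof -
    have "solid A 0 j \<noteq> 0" unfolding A_def by (rule solid_Phi_nonzero[OF z]) (use j in auto)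
    then show ?thesis using banded_solid_0[OF A, of j] j by auto
  qed
  have ndA: "solid (xmat n j a * A) q s \<noteq> 0" if "q < min m n" "q + s \<le> n" for q s
    using nd that rmin_right_unitri[OF Xc V(1), of s "(+) q"] unfolding XF nondeg_def by auto
  \<comment> \<open>The leading block of order j of \<open>xmat n j a * A\<close> is still lower
    triangular, with this number as its last diagonal entry.\<close>
  have sum: "A $$ (j - 1, j - 1) + a * A $$ (j, j - 1) \<noteq> 0"
  proof -
    have "solid (xmat n j a * A) 0 j = (\<Prod>i<j. (xmat n j a * A) $$ (i, i))"
      unfolding rmin_def
      by (subst det_mat_lower)
        (use j in \<open>auto simp: xmat_mult_entry[OF Ac] banded_upper[OF A] simp del: index_mult_mat(1)\<close>)
    moreover have "solid (xmat n j a * A) 0 j \<noteq> 0" using m j by (intro ndA) auto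
    ultimately have "(xmat n j a * A) $$ (j - 1, j - 1) \<noteq> 0" using j by auto
    then show ?thesis using j xmat_mult_entry[OF Ac j, of "j - 1" "j - 1" a] by simp
  qed
  \<comment> \<open>The solution of (c - 1) * \<open>phi_bar m n j z\<close> = a.\<close>
  define c where "c = 1 + a * A $$ (j, j - 1) / A $$ (j - 1, j - 1)"
  have c_eq: "c = (A $$ (j - 1, j - 1) + a * A $$ (j, j - 1)) / A $$ (j - 1, j - 1)"
    using diag by (simp add: c_def field_simps)
  have c0: "c \<noteq> 0" using sum diag by (simp add: c_eq)
  define b where "b = (inverse c - 1) * eps_bar m n j z"
  \<comment> \<open>In terms of a, the prescribed right parameter is exactly the one that clears the
    entry (j - 1, j).\<close>
  have b: "b = - a * A $$ (j, j) / (A $$ (j - 1, j - 1) + a * A $$ (j, j - 1))"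
    using sub diag sum
    by (simp add: b_def eps_bar_def ent_def A_def[symmetric] c_eq Let_def field_simps)
  define B where "B = xmat n j a * A * xmat n j b"
  have "(c - 1) * phi_bar m n j z = a"
    using sub diag by (simp add: phi_bar_def ent_def A_def[symmetric] c_def Let_def)
  then have e: "e_mat m n j c z = B"
    by (simp add: e_mat_def B_def A_def b_def)
  have bB: "banded n (min m n) B"
    unfolding B_def
  proof (rule banded_crystal_conj[OF A j])
    have "b * (A $$ (j - 1, j - 1) + a * A $$ (j, j - 1)) = - a * A $$ (j, j)"
      using sum by (simp add: b)
    then show "A $$ (j - 1, j - 1) * b + a * A $$ (j, j - 1) * b + a * A $$ (j, j) = 0"
      by (simp add: algebra_simps)
  qed
  have "solid B q s = solid (xmat n j a * A) q s" if "q + s \<le> n" for q s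
    unfolding B_def using that j by (intro rmin_right_unitri[OF Xc unitri_xmat]) auto
  then have ndB: "nondeg m n B" using ndA by (simp add: nondeg_def)
  have GT: "Psi m n B \<in> GT m n" and PhiB: "Phi m n (Psi m n B) = B"
    using Psi_banded[OF bB] ndB by (auto simp: nondeg_def)
  have "minor B {i + 1..j'} \<noteq> 0" if "1 \<le> i" "i \<le> m" "i \<le> j'" "j' \<le> n" for i j'
    using banded_nondeg[OF bB ndB, of i "j' - i"] that by (simp add: minor_interval)
  then have "e_defined m n j c z"
    using GT sub by (simp add: e_defined_def e_bar_def e ent_def A_def)
  then have "e_step m n z (Psi m n B)"
    unfolding e_step_def using j c0 by (intro exI[of _ j] exI[of _ c]) (auto simp: e_bar_def e)
  moreover have "rep m n (Psi m n B) (xmat n j a * F)"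
  proof -
    \<comment> \<open>The right factor of B is cancelled by its inverse, so the new unitriangular
      factor is \<open>xmat n j (- b) * V\<close>.\<close>
    have "B * (xmat n j (- b) * V) = xmat n j a * A * (xmat n j b * xmat n j (- b)) * V"
      unfolding B_def using assoc_mult_mat[OF Xc xmat_carrier xmat_carrier, of j b j "- b"]
        assoc_mult_mat[OF mult_carrier_mat[OF Xc xmat_carrier[of n j b]] xmat_carrier Vc, of j "- b"] by simp
    also have "\<dots> = xmat n j a * F"
      unfolding xmat_mult_inverse[OF j] XF right_mult_one_mat[OF Xc] ..
    finally show ?thesis
      unfolding rep_def PhiB using GT V j unitri_mult[OF unitri_xmat V(1), of j "- b"] by metis
  qed
  ultimately show ?thesis by blast
qed

text \<open>The shape is read off from the solid minors that reach the last row. On a set of bottom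
  rows \<open>xmat\<close> acts through a unitriangular block, which preserves them.\<close>

lemma e_step_shape:
  assumes z: "z \<in> GT_shape m n \<omega>" and st: "e_step m n z z'"
  shows "z' \<in> GT_shape m n \<omega>"
proof -
  have zG: "z \<in> GT m n" using z by (simp add: GT_shape_def)
  obtain j c where j: "1 \<le> j" "j < n" and z': "z' = e_bar m n j c z" "z' \<in> GT m n"
    using st by (auto simp: e_step_def e_defined_def)
  obtain a b where e: "e_mat m n j c z = xmat n j a * Phi m n z * xmat n j b"
    by (simp add: e_mat_def)
  have Xc: "xmat n j a * Phi m n z \<in> carrier_mat n n"
    by (intro mult_carrier_mat[OF xmat_carrier Phi_carrier])
  have sol: "solid (e_mat m n j c z) q (n - q) = solid (Phi m n z) q (n - q)" if "q \<le> n" for q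
  proof -
    have "solid (e_mat m n j c z) q (n - q) = solid (xmat n j a * Phi m n z) q (n - q)"
      unfolding e using that j by (intro rmin_right_unitri[OF Xc unitri_xmat]) auto
    also have "\<dots> = det (mat (n - q) (n - q) (\<lambda>(k, l). xmat n j a $$ (q + k, q + l)))
        * solid (Phi m n z) q (n - q)"
      by (rule solid_left[of _ n]) (use that j in \<open>auto simp: xmat_entry\<close>)
    also have "det (mat (n - q) (n - q) (\<lambda>(k, l). xmat n j a $$ (q + k, q + l))) = 1"
      by (subst det_mat_upper) (use j in \<open>auto simp: xmat_entry\<close>)
    finally show ?thesis by simp
  qed
  have "z' k n = z k n" if k: "k \<in> {1..min m n}" for k
  proof -
    have "k - 1 \<le> n" using k by auto
    then have "z' k n = Psi m n (Phi m n z) k n"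
      using k sol[OF \<open>k - 1 \<le> n\<close>] sol[of k] by (simp add: z' e_bar_def Psi_solid Suc_diff_le)
    then show ?thesis by (simp add: Psi_Phi[OF zG])
  qed
  then show ?thesis using z z' by (auto simp: GT_shape_def)
qed

lemma orbit_subset_shape:
  assumes "z0 \<in> GT_shape m n \<omega>"
  shows "orbit m n z0 \<subseteq> GT_shape m n \<omega>"
proof
  fix z assume "z \<in> orbit m n z0"
  then have "(e_step m n)\<^sup>*\<^sup>* z0 z" by (simp add: orbit_def)
  then show "z \<in> GT_shape m n \<omega>"
    by (induction rule: rtranclp_induct) (use assms e_step_shape in auto)
qed

subsection \<open>Unitriangular matrices as products of elementary ones\<close>

text \<open>The head of the list acts first, so the list order is the order of the steps along the
  path.\<close>

fun act :: "nat \<Rightarrow> (nat \<times> complex) list \<Rightarrow> complex mat \<Rightarrow> complex mat" where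
  "act n [] A = A"
| "act n ((j, a) # w) A = act n w (xmat n j a * A)"

definition word :: "nat \<Rightarrow> (nat \<times> complex) list \<Rightarrow> bool" where
  "word n w \<longleftrightarrow> (\<forall>(j, a) \<in> set w. 1 \<le> j \<and> j < n)"

text \<open>An explicit word is kept instead of a single element of U because its letters become the
  crystal operators of the path and its parameters get rescaled.\<close>

definition reach :: "nat \<Rightarrow> complex mat \<Rightarrow> complex mat \<Rightarrow> bool" where
  "reach n A B \<longleftrightarrow> (\<exists>w. word n w \<and> act n w A = B)"

lemma word_simps [simp]:
  "word n []" "word n ((j, a) # w) \<longleftrightarrow> 1 \<le> j \<and> j < n \<and> word n w"
  "word n (v @ w) \<longleftrightarrow> word n v \<and> word n w"
  by (auto simp: word_def)

lemma act_append: "act n (v @ w) A = act n w (act n v A)"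
  by (induction v arbitrary: A) auto

lemma act_mult:
  assumes "A \<in> carrier_mat n n" "B \<in> carrier_mat n n"
  shows "act n w (B * A) = act n w B * A"
  using assms(2)
proof (induction w arbitrary: B)
  case (Cons x w)
  obtain j a where x: "x = (j, a)" by (cases x)
  have "xmat n j a * (B * A) = xmat n j a * B * A"
    by (rule assoc_mult_mat[symmetric, OF xmat_carrier Cons.prems assms(1)])
  then show ?case using Cons.IH[OF mult_carrier_mat[OF xmat_carrier Cons.prems]] by (simp add: x)
qed simp

lemma reach_refl [simp]: "reach n A A"
  unfolding reach_def by (intro exI[of _ "[]"]) simp

lemma reach_trans: "reach n A B \<Longrightarrow> reach n B C \<Longrightarrow> reach n A C"
  unfolding reach_def using act_append word_simps(3) by metis

lemma reach_xmat: "1 \<le> j \<Longrightarrow> j < n \<Longrightarrow> reach n A (xmat n j a * A)"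
  unfolding reach_def by (intro exI[of _ "[(j, a)]"]) simp

lemma act_reach_back:
  assumes "A \<in> carrier_mat n n" "word n w"
  shows "reach n (act n w A) A"
  using assms
proof (induction w arbitrary: A)
  case (Cons x w)
  obtain j a where x: "x = (j, a)" by (cases x)
  have j: "1 \<le> j" "j < n" using Cons.prems by (auto simp: x)
  have "reach n (act n (x # w) A) (xmat n j a * A)"
    using Cons.IH[OF mult_carrier_mat[OF xmat_carrier Cons.prems(1)]] Cons.prems by (simp add: x)
  moreover have "reach n (xmat n j a * A) (xmat n j (- a) * (xmat n j a * A))"
    by (rule reach_xmat[OF j])
  moreover have "xmat n j (- a) * (xmat n j a * A) = A"
    using assoc_mult_mat[OF xmat_carrier xmat_carrier Cons.prems(1), of j "- a" j a]
      xmat_mult_inverse[OF j, of "- a"] Cons.prems(1) by simp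
  ultimately show ?case by (metis reach_trans)
qed simp

lemma reach_sym: "reach n A B \<Longrightarrow> A \<in> carrier_mat n n \<Longrightarrow> reach n B A"
  using act_reach_back unfolding reach_def by blast

lemma reach_addrow_Suc:
  assumes A: "A \<in> carrier_mat n n" and r: "Suc r < n"
  shows "reach n A (addrow a r (Suc r) A)"
proof -
  have "addrow a r (Suc r) A = xmat n (Suc r) a * A"
  proof (rule eq_matI)
    show "addrow a r (Suc r) A $$ (k, l) = (xmat n (Suc r) a * A) $$ (k, l)"
      if "k < dim_row (xmat n (Suc r) a * A)" "l < dim_col (xmat n (Suc r) a * A)" for k l
    proof -
      have kl: "k < n" "l < n" using that A by (auto simp: xmat_def)
      then show ?thesis using A xmat_mult_entry[OF A _ r kl] by auto
    qed
  qed (use A in \<open>auto simp: xmat_def\<close>)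
  then show ?thesis using reach_xmat[of "Suc r" n A a] r by simp
qed

text \<open>The inductive step is the commutator of the root subgroups of \<open>(i, r)\<close> and \<open>(r, r + 1)\<close>.\<close>

lemma reach_addrow:
  assumes "i < r" "r < n" "A \<in> carrier_mat n n"
  shows "reach n A (addrow a i r A)"
proof -
  have "Suc i \<le> r" using assms by simp
  then show ?thesis using assms(2,3)
  proof (induction r arbitrary: a A rule: dec_induct)
    case base
    then show ?case by (intro reach_addrow_Suc)
  next
    case (step r)
    \<comment> \<open>Row i first gains -a times (row r minus row r + 1), then, with row r restored,
      a times row r; the total is a times row r + 1.\<close>
    define A1 where "A1 = addrow (- 1) r (Suc r) A"
    define A2 where "A2 = addrow (- a) i r A1"
    define A3 where "A3 = addrow 1 r (Suc r) A2"
    have c: "A1 \<in> carrier_mat n n" "A2 \<in> carrier_mat n n" "A3 \<in> carrier_mat n n"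
      using step.prems by (auto simp: A1_def A2_def A3_def)
    have "reach n A A1" "reach n A2 A3"
      unfolding A1_def A3_def using reach_addrow_Suc step.prems c by auto
    moreover have "reach n A1 A2" "reach n A3 (addrow a i r A3)"
      unfolding A2_def using step.IH step.prems c by auto
    moreover have "addrow a i r A3 = addrow a i (Suc r) A"
      unfolding A3_def A2_def A1_def
      by (rule eq_matI) (use step in \<open>auto simp: algebra_simps\<close>)
    ultimately show ?case by (metis reach_trans)
  qed
qed

text \<open>Starting from the identity, u is filled in from the top row down (\<open>T\<close>) and
  from left to right within a row (\<open>S\<close>). When the entry (i, r) is set, row r is below
  row i and still a unit vector, so one row addition suffices.\<close>

lemma reach_one_unitri:
  assumes u: "unitri n u"
  shows "reach n (1\<^sub>m n) u"
proof -
  define T where "T i = mat n n (\<lambda>(k, l). if k < i then u $$ (k, l) else if k = l then 1 else 0)" for i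
  define S where "S i r = mat n n (\<lambda>(k, l). if k < i \<or> k = i \<and> l < r then u $$ (k, l) else if k = l then 1 else 0)"
    for i r
  have "reach n (T i) (T (Suc i))" if "i < n" for i
  proof -
    have "reach n (S i (Suc i)) (S i r)" if "Suc i \<le> r" "r \<le> n" for r
      using that
    proof (induction r rule: dec_induct)
      case (step r)
      have "S i (Suc r) = addrow (u $$ (i, r)) i r (S i r)"
        by (rule eq_matI) (use step \<open>i < n\<close> in \<open>auto simp: S_def less_Suc_eq\<close>)
      moreover have "reach n (S i r) (addrow (u $$ (i, r)) i r (S i r))"
        by (rule reach_addrow) (use step in \<open>auto simp: S_def\<close>)
      ultimately show ?case using step by (metis Suc_leD reach_trans)
    qed simp
    moreover have "S i (Suc i) = T i"
      by (rule eq_matI) (use u \<open>i < n\<close> in \<open>auto simp: S_def T_def unitri_def less_Suc_eq\<close>)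
    moreover have "S i n = T (Suc i)"
      by (rule eq_matI) (auto simp: S_def T_def)
    ultimately show ?thesis using that by (metis Suc_leI le_refl)
  qed
  then have "reach n (T 0) (T i)" if "i \<le> n" for i
    using that by (induction i) (auto intro: reach_trans)
  moreover have "T 0 = 1\<^sub>m n" by (rule eq_matI) (auto simp: T_def)
  moreover have "T n = u" by (rule eq_matI) (use u in \<open>auto simp: T_def unitri_def\<close>)
  ultimately show ?thesis by (metis le_refl)
qed

lemma reach_unitri:
  assumes "unitri n u" "A \<in> carrier_mat n n"
  shows "reach n A (u * A)"
  using reach_one_unitri[OF assms(1)] act_mult[OF assms(2) one_carrier_mat] assms(2)
  unfolding reach_def by (metis left_mult_one_mat)

subsection \<open>Transitivity on a fixed shape\<close>

lemma solve_square_system: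
  fixes f :: "nat \<times> nat \<Rightarrow> complex"
  assumes "det (mat s s f) \<noteq> 0"
  shows "\<exists>x. \<forall>i<s. (\<Sum>l<s. f (i, l) * x l) = b i"
proof -
  let ?C = "mat s s f"
  obtain D where D: "D \<in> carrier_mat s s" "?C * D = 1\<^sub>m s"
    using det_non_zero_imp_unit[of ?C s "()"] assms unfolding Units_def by (auto simp: ring_mat_def)
  let ?x = "D *\<^sub>v vec s b"
  have eq: "?C *\<^sub>v ?x = vec s b"
  proof -
    have "?C *\<^sub>v ?x = (?C * D) *\<^sub>v vec s b"
      using D by (intro assoc_mult_mat_vec[symmetric]) auto
    then show ?thesis by (simp add: D)
  qed
  have "(\<Sum>l<s. f (i, l) * ?x $ l) = b i" if "i < s" for i
  proof -
    have "(?C *\<^sub>v ?x) $ i = (\<Sum>l<s. f (i, l) * ?x $ l)"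
      using that D by (auto simp: scalar_prod_def atLeast0LessThan simp del: index_mult_mat_vec(1)
          simp: index_mult_mat_vec(1)[of i ?C])
    then show ?thesis using that by (simp add: eq)
  qed
  then show ?thesis by blast
qed

text \<open>The first \<open>n - p\<close> columns have their lowest nonzero entry on the band; in the remaining ones the
  nonvanishing corner minors force an antidiagonal.\<close>

definition pivot :: "nat \<Rightarrow> nat \<Rightarrow> nat \<Rightarrow> nat" where
  "pivot n p k = (if k < n - p then p + k else n - 1 - k)"

text \<open>For k at least n - p, the k entries of column k below the antidiagonal are cleared with
  the k preceding columns of A; the matrix of this linear system has determinant
  \<open>solid A (n - k) k\<close>. Earlier columns stay as they are.\<close>

lemma column_echelon:
  assumes A: "banded n p A" and p: "p \<le> n"
    and nz: "\<And>k. n - p \<le> k \<Longrightarrow> k < n \<Longrightarrow> solid A (n - k) k \<noteq> 0"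
  shows "\<exists>V. unitri n V \<and> (\<forall>k<n. \<forall>i<n. pivot n p k < i \<longrightarrow> (A * V) $$ (i, k) = 0)
    \<and> (\<forall>k<n - p. (A * V) $$ (p + k, k) = 1)"
proof -
  have "\<exists>x. \<forall>i<n. n - 1 - k < i \<longrightarrow> A $$ (i, k) + (\<Sum>l<k. A $$ (i, l) * x l) = 0"
    if "n - p \<le> k" "k < n" for k
  proof -
    obtain x where x: "\<And>i. i < k \<Longrightarrow> (\<Sum>l<k. A $$ (n - k + i, l) * x l) = - A $$ (n - k + i, k)"
      using solve_square_system[of k "\<lambda>(a, b). A $$ (n - k + a, b)" "\<lambda>i. - A $$ (n - k + i, k)"] nz[OF \<open>n - p \<le> k\<close> \<open>k < n\<close>]
      by (auto simp: rmin_def)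
    have "A $$ (i, k) + (\<Sum>l<k. A $$ (i, l) * x l) = 0" if "i < n" "n - 1 - k < i" for i
      using x[of "i - (n - k)"] that \<open>k < n\<close> by auto
    then show ?thesis by blast
  qed
  then have "\<forall>k\<in>{n - p..<n}. \<exists>x. \<forall>i<n. n - 1 - k < i \<longrightarrow> A $$ (i, k) + (\<Sum>l<k. A $$ (i, l) * x l) = 0"
    by simp
  from bchoice[OF this] obtain x where
    x0: "\<forall>k\<in>{n - p..<n}. \<forall>i<n. n - 1 - k < i \<longrightarrow> A $$ (i, k) + (\<Sum>l<k. A $$ (i, l) * x k l) = 0"
    by blast
  have x: "A $$ (i, k) + (\<Sum>l<k. A $$ (i, l) * x k l) = 0"
    if "n - p \<le> k" "k < n" "i < n" "n - 1 - k < i" for k i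
    using x0 that by simp
  define V where "V = mat n n (\<lambda>(l, k). if l = k then 1 else if l < k \<and> n - p \<le> k then x k l else 0)"
  have V: "unitri n V" by (auto simp: V_def unitri_def)
  have e: "(A * V) $$ (i, k) = A $$ (i, k) + (if n - p \<le> k then \<Sum>l<k. A $$ (i, l) * x k l else 0)"
    if "i < n" "k < n" for i k
  proof -
    have "(A * V) $$ (i, k) = (\<Sum>l<n. A $$ (i, l) * V $$ (l, k))"
      by (rule mult_entry[OF banded_carrier[OF A] unitri_carrier[OF V] that])
    also have "\<dots> = (\<Sum>l<n. (if l = k then A $$ (i, k) else 0) +
        (if l < k then (if n - p \<le> k then A $$ (i, l) * x k l else 0) else 0))"
      by (rule sum.cong) (use that in \<open>auto simp: V_def\<close>)
    also have "\<dots> = A $$ (i, k) + (\<Sum>l<n. if l < k then (if n - p \<le> k then A $$ (i, l) * x k l else 0) else 0)"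
      using that by (simp add: sum.distrib)
    also have "(\<Sum>l<n. if l < k then (if n - p \<le> k then A $$ (i, l) * x k l else 0) else 0) =
        (\<Sum>l<k. if n - p \<le> k then A $$ (i, l) * x k l else 0)"
      by (rule sum.mono_neutral_cong_right) (use that in auto)
    finally show ?thesis by simp
  qed
  have "(A * V) $$ (i, k) = 0" if "k < n" "i < n" "pivot n p k < i" for i k
    using that x[of k i] banded_below[OF A, of k i] by (auto simp: e pivot_def split: if_splits)
  moreover have "(A * V) $$ (p + k, k) = 1" if "k < n - p" for k
    using that banded_one[OF A, of "p + k" k] by (auto simp: e)
  ultimately show ?thesis using V by blast
qed

text \<open>Expansion along the last column has one surviving term. Thus an antidiagonal entry is,
  up to sign, a quotient of consecutive corner minors.\<close>

lemma corner_expansion: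
  assumes z: "\<And>i. n - 1 - k < i \<Longrightarrow> i < n \<Longrightarrow> R $$ (i, k) = 0" and k: "k < n"
  shows "solid R (n - 1 - k) (Suc k) = (-1) ^ k * R $$ (n - 1 - k, k) * solid R (n - k) k"
proof -
  let ?M = "mat (Suc k) (Suc k) (\<lambda>(a, b). R $$ (n - 1 - k + a, b))"
  have "det ?M = (\<Sum>i<Suc k. ?M $$ (i, k) * cofactor ?M i k)"
    by (rule laplace_expansion_column) auto
  also have "\<dots> = (\<Sum>i<Suc k. if i = 0 then ?M $$ (0, k) * cofactor ?M 0 k else 0)"
    by (rule sum.cong) (use k in \<open>auto intro!: z\<close>)
  also have "\<dots> = R $$ (n - 1 - k, k) * cofactor ?M 0 k" by simp
  also have "cofactor ?M 0 k = (-1) ^ k * solid R (n - k) k"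
  proof -
    have "mat_delete ?M 0 k = mat k k (\<lambda>(a, b). R $$ (n - k + a, b))"
      by (rule eq_matI) (use k in \<open>auto simp: mat_delete_def Suc_diff_Suc\<close>)
    then show ?thesis by (simp add: cofactor_def rmin_def)
  qed
  finally show ?thesis by (simp add: rmin_def)
qed

text \<open>\<open>pivot n p\<close> permutes the indices. Sorting the columns of R by pivot row and
  dividing each by its pivot yields the unitriangular factor.\<close>

lemma echelon_factor:
  assumes R: "R \<in> carrier_mat n n" and p: "p \<le> n"
    and z: "\<And>k i. k < n \<Longrightarrow> i < n \<Longrightarrow> pivot n p k < i \<Longrightarrow> R $$ (i, k) = 0"
    and d: "\<And>k. k < n \<Longrightarrow> R $$ (pivot n p k, k) = d k" "\<And>k. k < n \<Longrightarrow> d k \<noteq> 0"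
  shows "\<exists>u. unitri n u \<and> R = u * mat n n (\<lambda>(i, k). if i = pivot n p k then d k else 0)"
proof -
  let ?M = "mat n n (\<lambda>(i, k). if i = pivot n p k then d k else 0)"
  define q where "q j = (if p \<le> j then j - p else n - 1 - j)" for j
  have q: "pivot n p (q j) = j" "q j < n" if "j < n" for j
    using that p by (auto simp: q_def pivot_def)
  have piv: "q (pivot n p k) = k" "pivot n p k < n" if "k < n" for k
    using that p by (auto simp: q_def pivot_def)
  define u where "u = mat n n (\<lambda>(i, j). R $$ (i, q j) / d (q j))"
  have "R $$ (i, q i) / d (q i) = 1" if "i < n" for i
    using q[OF that] d[of "q i"] by simp
  moreover have "R $$ (i, q j) = 0" if "i < n" "j < i" for i j
    using q[of j] z[of "q j" i] that by simp
  ultimately have u: "unitri n u"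
    by (auto simp: unitri_def u_def)
  moreover have "R = u * ?M"
  proof (rule eq_matI)
    fix i k assume "i < dim_row (u * ?M)" "k < dim_col (u * ?M)"
    then have ik: "i < n" "k < n" by (auto simp: u_def)
    have "(u * ?M) $$ (i, k) = (\<Sum>j<n. u $$ (i, j) * ?M $$ (j, k))"
      by (rule mult_entry[OF unitri_carrier[OF u] _ ik]) simp
    also have "\<dots> = (\<Sum>j<n. if j = pivot n p k then R $$ (i, k) else 0)"
      by (rule sum.cong) (use ik piv d in \<open>auto simp: u_def\<close>)
    finally show "R $$ (i, k) = (u * ?M) $$ (i, k)" using ik piv by simp
  qed (use R in \<open>auto simp: u_def\<close>)
  ultimately show ?thesis by blast
qed

text \<open>Both echelon forms are unitriangular multiples of one monomial matrix, so they are
  joined by a path through it, traversed backwards on the first half.\<close>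

lemma banded_reach:
  assumes A: "banded n p A" and B: "banded n p B" and p: "p \<le> n"
    and eq: "\<And>k. n - p \<le> k \<Longrightarrow> k \<le> n \<Longrightarrow> solid A (n - k) k = solid B (n - k) k"
    and nz: "\<And>k. n - p \<le> k \<Longrightarrow> k \<le> n \<Longrightarrow> solid A (n - k) k \<noteq> 0"
  shows "\<exists>U V. unitri n U \<and> unitri n V \<and> reach n (A * U) (B * V)"
proof -
  from column_echelon[OF A p nz[OF _ less_imp_le]] obtain U where U: "unitri n U"
      "\<And>k i. k < n \<Longrightarrow> i < n \<Longrightarrow> pivot n p k < i \<Longrightarrow> (A * U) $$ (i, k) = 0"
      "\<And>k. k < n - p \<Longrightarrow> (A * U) $$ (p + k, k) = 1"
    by blast
  have nz': "solid B (n - k) k \<noteq> 0" if "n - p \<le> k" "k < n" for k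
    using nz[of k] eq[of k] that by simp
  from column_echelon[OF B p nz'] obtain V where V: "unitri n V"
      "\<And>k i. k < n \<Longrightarrow> i < n \<Longrightarrow> pivot n p k < i \<Longrightarrow> (B * V) $$ (i, k) = 0"
      "\<And>k. k < n - p \<Longrightarrow> (B * V) $$ (p + k, k) = 1"
    by blast
  have c: "A * U \<in> carrier_mat n n" "B * V \<in> carrier_mat n n"
    using banded_carrier[OF A] banded_carrier[OF B] U(1) V(1) by (auto simp: unitri_def)
  define d where "d k = (A * U) $$ (pivot n p k, k)" for k
  have d: "(B * V) $$ (pivot n p k, k) = d k \<and> d k \<noteq> 0" if k: "k < n" for k
  proof (cases "k < n - p")
    case True
    then show ?thesis using U(3) V(3) by (simp add: d_def pivot_def)
  next
    case False
    have sA: "solid (A * U) (n - l) l = solid A (n - l) l" if "l \<le> n" for l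
      by (rule rmin_right_unitri[OF banded_carrier[OF A] U(1)]) (use that in auto)
    have sB: "solid (B * V) (n - l) l = solid B (n - l) l" if "l \<le> n" for l
      by (rule rmin_right_unitri[OF banded_carrier[OF B] V(1)]) (use that in auto)
    \<comment> \<open>In the antidiagonal columns the pivots of A and B agree because the corner
      minors do.\<close>
    have "solid A (n - Suc k) (Suc k) = (-1) ^ k * (A * U) $$ (n - 1 - k, k) * solid A (n - k) k"
      using corner_expansion[of n k "A * U"] U(2)[of k] False k sA[of k] sA[of "Suc k"]
      by (auto simp: pivot_def)
    moreover have "solid B (n - Suc k) (Suc k) = (-1) ^ k * (B * V) $$ (n - 1 - k, k) * solid B (n - k) k"
      using corner_expansion[of n k "B * V"] V(2)[of k] False k sB[of k] sB[of "Suc k"]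
      by (auto simp: pivot_def)
    ultimately show ?thesis
      using eq[of k] eq[of "Suc k"] nz[of k] nz[of "Suc k"] False k by (auto simp: d_def pivot_def)
  qed
  let ?M = "mat n n (\<lambda>(i, k). if i = pivot n p k then d k else 0)"
  obtain u where u: "unitri n u" "A * U = u * ?M"
    using echelon_factor[OF c(1) p U(2), of d] d by (auto simp: d_def)
  obtain v where v: "unitri n v" "B * V = v * ?M"
    using echelon_factor[OF c(2) p V(2), of d] d by auto
  have "reach n ?M (A * U)" "reach n ?M (B * V)"
    unfolding u(2) v(2) by (rule reach_unitri; use u v in simp)+
  then have "reach n (A * U) (B * V)"
    using reach_trans reach_sym[OF _ mat_carrier] by blast
  then show ?thesis using U V by blast
qed

subsection \<open>A generic path inside the orbit\<close>

text \<open>All entries of row \<open>i\<close> equal \<open>\<omega> i\<close>, so that \<open>A\<^sub>j\<^sub>+\<^sub>1\<^sub>,\<^sub>j\<close> is a positive integer times a nonzero factor.\<close>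

definition const_pattern :: "nat \<Rightarrow> nat \<Rightarrow> (nat \<Rightarrow> complex) \<Rightarrow> nat \<Rightarrow> nat \<Rightarrow> complex" where
  "const_pattern m n \<omega> i j = (if 1 \<le> i \<and> i \<le> m \<and> i \<le> j \<and> j \<le> n then \<omega> i else 0)"

lemma const_pattern_shape:
  assumes "\<forall>k\<in>{1..min m n}. \<omega> k \<noteq> 0"
  shows "const_pattern m n \<omega> \<in> GT_shape m n \<omega>"
  using assms by (auto simp: GT_shape_def GT_def const_pattern_def)

lemma Wargs_const_pattern:
  assumes "\<forall>k\<in>{1..min m n}. \<omega> k \<noteq> 0" "r < m" "r \<le> k" "k < n"
  shows "Wargs (const_pattern m n \<omega>) (Suc r) (k + 1) = (if k = r then \<omega> (Suc k) else 1)"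
  using assms by (auto simp: Wargs_def const_pattern_def)

lemma Phi_aux_const_pattern_diag:
  assumes \<omega>: "\<forall>k\<in>{1..min m n}. \<omega> k \<noteq> 0" and "r \<le> m" "k < n"
  shows "Phi_aux n (const_pattern m n \<omega>) r $$ (k, k) = (if k < r then \<omega> (Suc k) else 1)"
  using assms(2)
proof (induction r)
  case 0
  then show ?case using assms by simp
next
  case (Suc r)
  then show ?case
    using Wargs_const_pattern[OF \<omega>, of r k] \<open>k < n\<close> banded_upper[OF banded_Phi_aux, of "k - 1" k]
    by (auto simp: Wmat_mult_entry)
qed

text \<open>Each of the first k + 1 factors adds the entry (k, k) of the preceding product, which is
  still 1; the next factor scales the row by its \<omega>.\<close>

lemma Phi_aux_const_pattern_subdiag:
  assumes \<omega>: "\<forall>k\<in>{1..min m n}. \<omega> k \<noteq> 0" and "r \<le> m" "Suc k < n"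
  shows "Phi_aux n (const_pattern m n \<omega>) r $$ (Suc k, k)
    = of_nat (min r (Suc k)) * (if Suc k < r then \<omega> (Suc (Suc k)) else 1)"
  using assms(2)
proof (induction r)
  case 0
  then show ?case using assms by simp
next
  case (Suc r)
  have "Phi_aux n (const_pattern m n \<omega>) (Suc r) $$ (Suc k, k) =
      (if Suc k < r then 1 else Wargs (const_pattern m n \<omega>) (Suc r) (Suc k + 1)) *
        Phi_aux n (const_pattern m n \<omega>) r $$ (Suc k, k) +
      (if Suc r \<le> Suc k then Phi_aux n (const_pattern m n \<omega>) r $$ (k, k) else 0)"
    using \<open>Suc k < n\<close> by (simp add: Wmat_mult_entry)
  also have "\<dots> = of_nat (min (Suc r) (Suc k)) * (if Suc k < Suc r then \<omega> (Suc (Suc k)) else 1)"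
    using Suc Wargs_const_pattern[OF \<omega>, of r "Suc k"] Phi_aux_const_pattern_diag[OF \<omega>, of r k] \<open>Suc k < n\<close>
    by (cases "r < Suc k"; cases "r = Suc k") (auto simp: min_def)
  finally show ?case .
qed

lemma Phi_const_pattern_skip_row:
  assumes \<omega>: "\<forall>k\<in>{1..min m n}. \<omega> k \<noteq> 0" and "1 \<le> m" and j: "1 \<le> j" "j < n"
  shows "rmin (Phi m n (const_pattern m n \<omega>)) (skip_row j) j \<noteq> 0"
proof -
  obtain k where k: "j = Suc k" using j by (cases j) auto
  let ?A = "Phi m n (const_pattern m n \<omega>)"
  have "?A $$ (i, i) \<noteq> 0" if "i < n" for i
    using Phi_aux_const_pattern_diag[OF \<omega>, of "min m n" i] that \<omega> by (auto simp: Phi_def)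
  moreover have "?A $$ (Suc k, k) \<noteq> 0"
    using Phi_aux_const_pattern_subdiag[OF \<omega>, of "min m n" k] j \<omega> \<open>1 \<le> m\<close> by (auto simp: Phi_def k min_def)
  ultimately show ?thesis
    using rmin_skip_row_banded[OF banded_Phi j, of m "const_pattern m n \<omega>"] j by (auto simp: k)
qed

section \<open>Polynomial dependence on a parameter\<close>

definition polynomial_family :: "(complex \<Rightarrow> complex) \<Rightarrow> bool" where
  "polynomial_family g \<longleftrightarrow> (\<exists>q. \<forall>t. g t = poly q t)"

lemma polynomial_family_const [simp]: "polynomial_family (\<lambda>t. c)"
  unfolding polynomial_family_def by (intro exI[of _ "[:c:]"]) simp

lemma polynomial_family_id: "polynomial_family (\<lambda>t. t)"
  unfolding polynomial_family_def by (intro exI[of _ "[:0, 1:]"]) simp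

lemma polynomial_family_add:
  "polynomial_family f \<Longrightarrow> polynomial_family g \<Longrightarrow> polynomial_family (\<lambda>t. f t + g t)"
  unfolding polynomial_family_def by (metis poly_add)

lemma polynomial_family_mult:
  "polynomial_family f \<Longrightarrow> polynomial_family g \<Longrightarrow> polynomial_family (\<lambda>t. f t * g t)"
  unfolding polynomial_family_def by (metis poly_mult)

lemma polynomial_family_sum:
  "(\<And>i. i \<in> I \<Longrightarrow> polynomial_family (f i)) \<Longrightarrow> polynomial_family (\<lambda>t. \<Sum>i\<in>I. f i t)"
  by (induction I rule: infinite_finite_induct) (auto intro: polynomial_family_add)

lemma polynomial_family_prod:
  "(\<And>i. i \<in> I \<Longrightarrow> polynomial_family (f i)) \<Longrightarrow> polynomial_family (\<lambda>t. \<Prod>i\<in>I. f i t)"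
  by (induction I rule: infinite_finite_induct) (auto intro: polynomial_family_mult)

lemma polynomial_family_nonzero:
  assumes "polynomial_family g" "g 0 \<noteq> 0"
  shows "\<forall>\<^sub>F t in cofinite. g t \<noteq> 0"
proof -
  obtain q where q: "\<And>t. g t = poly q t" using assms(1) by (auto simp: polynomial_family_def)
  then have "q \<noteq> 0" using assms(2) by auto
  then show ?thesis using poly_roots_finite[of q] by (simp add: eventually_cofinite q)
qed

lemma polynomial_family_tendsto:
  assumes "polynomial_family g"
  shows "(g \<longlongrightarrow> g c) (at c)"
proof -
  obtain q where "g = poly q" using assms by (auto simp: polynomial_family_def)
  then show ?thesis by (simp add: tendsto_poly)
qed

definition polynomial_mat :: "nat \<Rightarrow> (complex \<Rightarrow> complex mat) \<Rightarrow> bool" where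
  "polynomial_mat n F \<longleftrightarrow> (\<forall>t. F t \<in> carrier_mat n n) \<and>
     (\<forall>k<n. \<forall>l<n. polynomial_family (\<lambda>t. F t $$ (k, l)))"

lemma polynomial_mat_rmin:
  assumes "polynomial_mat n F" "s \<le> n" "\<And>a. a < s \<Longrightarrow> \<rho> a < n"
  shows "polynomial_family (\<lambda>t. rmin (F t) \<rho> s)"
proof -
  have eq: "(\<lambda>t. rmin (F t) \<rho> s) =
      (\<lambda>t. \<Sum>p | p permutes {0..<s}. signof p * (\<Prod>i = 0..<s. F t $$ (\<rho> i, p i)))"
    by (auto simp: rmin_def det_def intro!: sum.cong prod.cong)
  show ?thesis unfolding eq
  proof (intro polynomial_family_sum polynomial_family_mult polynomial_family_prod polynomial_family_const)
    fix p i assume p: "p \<in> {p. p permutes {0..<s}}" and i: "i \<in> {0..<s}"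
    then have "p i \<in> {0..<s}" by (simp only: mem_Collect_eq permutes_in_image)
    then have "\<rho> i < n" "p i < n" using i assms(2,3) by auto
    then show "polynomial_family (\<lambda>t. F t $$ (\<rho> i, p i))"
      using assms(1) by (simp add: polynomial_mat_def)
  qed
qed

lemma polynomial_mat_xmat_mult:
  assumes F: "polynomial_mat n F" and j: "1 \<le> j" "j < n"
  shows "polynomial_mat n (\<lambda>t. xmat n j (t * a) * F t)"
  unfolding polynomial_mat_def
proof (intro conjI allI impI)
  have c: "F t \<in> carrier_mat n n" for t using F by (simp add: polynomial_mat_def)
  show "xmat n j (t * a) * F t \<in> carrier_mat n n" for t
    by (rule mult_carrier_mat[OF xmat_carrier c])
  fix k l assume kl: "k < n" "l < n"
  show "polynomial_family (\<lambda>t. (xmat n j (t * a) * F t) $$ (k, l))"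
    unfolding xmat_mult_entry[OF c j kl] using F kl j
    by (cases "k + 1 = j")
      (auto simp: polynomial_mat_def intro!: polynomial_family_add polynomial_family_mult polynomial_family_id)
qed

text \<open>As t runs from 0 to 1, the product of the letters moves from the identity to the given
  word.\<close>

definition scale :: "complex \<Rightarrow> (nat \<times> complex) list \<Rightarrow> (nat \<times> complex) list" where
  "scale t w = map (\<lambda>(j, a). (j, t * a)) w"

lemma scale_simps [simp]:
  "scale t [] = []" "scale t ((j, a) # w) = (j, t * a) # scale t w" "scale 1 w = w"
  by (auto simp: scale_def)

lemma polynomial_mat_act:
  assumes "polynomial_mat n F" "word n w"
  shows "polynomial_mat n (\<lambda>t. act n (scale t w) (F t))"
  using assms
proof (induction w arbitrary: F)
  case (Cons x w)
  obtain j a where x: "x = (j, a)" by (cases x)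
  then show ?case
    using Cons.IH[OF polynomial_mat_xmat_mult[OF Cons.prems(1), of j a]] Cons.prems(2) by simp
qed simp

text \<open>All genericity conditions along the path \<open>t \<mapsto> scale t w\<close> hold at \<open>t = 0\<close>, where every
  factor is the identity.\<close>

lemma act_scale_generic:
  assumes m: "1 \<le> m" and nd: "nondeg m n F0"
    and sk: "\<And>j. 1 \<le> j \<Longrightarrow> j < n \<Longrightarrow> rmin F0 (skip_row j) j \<noteq> 0"
    and "word n w" "polynomial_mat n F" "F 0 = F0"
    and "\<forall>\<^sub>F t in cofinite. \<exists>z\<in>orbit m n z0. rep m n z (F t)"
  shows "\<forall>\<^sub>F t in cofinite. \<exists>z\<in>orbit m n z0. rep m n z (act n (scale t w) (F t))"
  using assms(4-)
\<comment> \<open>The family F absorbs the letters already applied, so it has to vary in the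
  induction; its value at t = 0 remains \<open>F0\<close>.\<close>
proof (induction w arbitrary: F)
  case (Cons x w)
  obtain j a where x: "x = (j, a)" by (cases x)
  have j: "1 \<le> j" "j < n" and w: "word n w" using Cons.prems(1) by (auto simp: x)
  define G where "G t = xmat n j (t * a) * F t" for t
  have G: "polynomial_mat n G"
    using polynomial_mat_xmat_mult[OF Cons.prems(2) j, of a] by (simp add: G_def[abs_def])
  have "F 0 \<in> carrier_mat n n" using Cons.prems(2) by (simp add: polynomial_mat_def)
  then have G0: "G 0 = F0" using Cons.prems(3) by (simp add: G_def)
  have "\<forall>\<^sub>F t in cofinite. rmin (F t) (skip_row j) j \<noteq> 0"
    by (intro polynomial_family_nonzero polynomial_mat_rmin[OF Cons.prems(2)])
      (use j sk Cons.prems(3) in \<open>auto simp: skip_row_def\<close>)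
  moreover have "\<forall>\<^sub>F t in cofinite. nondeg m n (G t)"
  proof -
    have "\<forall>\<^sub>F t in cofinite. \<forall>q\<in>{..<min m n}. \<forall>s\<in>{..n - q}. solid (G t) q s \<noteq> 0"
      by (intro eventually_ball_finite ballI finite_lessThan finite_atMost polynomial_family_nonzero
          polynomial_mat_rmin[OF G]) (use nd in \<open>auto simp: G0 nondeg_def\<close>)
    then show ?thesis by eventually_elim (auto simp: nondeg_def)
  qed
  ultimately have "\<forall>\<^sub>F t in cofinite. \<exists>z\<in>orbit m n z0. rep m n z (G t)"
    using Cons.prems(4)
  proof eventually_elim
    case (elim t)
    then obtain z where z: "z \<in> orbit m n z0" "rep m n z (F t)" by blast
    with crystal_step[OF m z(2) j elim(1)] elim(2) obtain z' where
      "e_step m n z z'" "rep m n z' (G t)" unfolding G_def by blast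
    then show ?case using z(1) unfolding orbit_def by (auto intro: rtranclp.rtrancl_into_rtrancl)
  qed
  then have "\<forall>\<^sub>F t in cofinite. \<exists>z\<in>orbit m n z0. rep m n z (act n (scale t w) (G t))"
    by (rule Cons.IH[OF w G G0])
  then show ?case by (simp add: x G_def)
qed simp

lemma poly_fun_tendsto:
  assumes "f \<in> poly_fun" "\<And>i j. ((\<lambda>t. Z t i j) \<longlongrightarrow> z i j) F"
  shows "((\<lambda>t. f (Z t)) \<longlongrightarrow> f z) F"
  using assms(1) by induction (auto intro: tendsto_intros assms(2))

lemma eventually_at_cofinite:
  fixes c :: "'a::t1_space"
  assumes "eventually P cofinite"
  shows "eventually P (at c)"
proof -
  have "open (- ({t. \<not> P t} - {c}))"
    using assms by (intro open_Compl finite_imp_closed) (simp add: eventually_cofinite)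
  then show ?thesis
    unfolding eventually_at_topological by (intro exI[of _ "- ({t. \<not> P t} - {c})"]) auto
qed

lemma orbit_const_pattern_dense:
  assumes m: "1 \<le> m" and \<omega>: "\<forall>k\<in>{1..min m n}. \<omega> k \<noteq> 0"
  shows "zariski_dense_in (orbit m n (const_pattern m n \<omega>)) (GT_shape m n \<omega>)"
  unfolding zariski_dense_in_def
proof (intro conjI ballI impI)
  let ?z0 = "const_pattern m n \<omega>"
  have z0: "?z0 \<in> GT_shape m n \<omega>" by (rule const_pattern_shape[OF \<omega>])
  then have z0G: "?z0 \<in> GT m n" by (simp add: GT_shape_def)
  show "orbit m n ?z0 \<subseteq> GT_shape m n \<omega>" by (rule orbit_subset_shape[OF z0])
  fix f z assume f: "f \<in> poly_fun" "\<forall>z\<in>orbit m n ?z0. f z = 0" and z: "z \<in> GT_shape m n \<omega>"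
  have zG: "z \<in> GT m n" using z by (simp add: GT_shape_def)
  \<comment> \<open>The corner minors depend on the shape only, which is what
    \<open>banded_reach\<close> requires.\<close>
  have cor: "solid (Phi m n z') (n - k) k = (\<Prod>i\<in>{n - k<..min m n}. \<omega> i)"
    if "z' \<in> GT_shape m n \<omega>" "n - min m n \<le> k" "k \<le> n" for z' k
    using solid_Phi[of z' m n "n - k" k] that by (auto simp: GT_shape_def min_def intro!: prod.cong)
  have "\<exists>U V. unitri n U \<and> unitri n V \<and> reach n (Phi m n ?z0 * U) (Phi m n z * V)"
    by (rule banded_reach[OF banded_Phi banded_Phi]) (use \<omega> in \<open>auto simp: cor z0 z\<close>)
  then obtain U V w where U: "unitri n U" and V: "unitri n V" and w: "word n w"
    and act: "act n w (Phi m n ?z0 * U) = Phi m n z * V"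
    by (auto simp: reach_def)
  define F0 where "F0 = Phi m n ?z0 * U"
  have rep0: "rep m n ?z0 F0" using U z0G by (auto simp: rep_def F0_def)
  have rep1: "rep m n z (Phi m n z * V)" using V zG by (auto simp: rep_def)
  have nd: "nondeg m n F0"
    using solid_Phi_nonzero[OF z0G] rep_rmin[OF rep0] by (auto simp: nondeg_def)
  have sk: "rmin F0 (skip_row j) j \<noteq> 0" if "1 \<le> j" "j < n" for j
    using Phi_const_pattern_skip_row[OF \<omega> m that] rep_rmin[OF rep0, of j "skip_row j"] that
    by (auto simp: skip_row_def)
  define G where "G t = act n (scale t w) F0" for t
  have F0: "polynomial_mat n (\<lambda>t. F0)" using rep_carrier[OF rep0] by (simp add: polynomial_mat_def)
  have G: "polynomial_mat n G"
    using polynomial_mat_act[OF F0 w] by (simp add: G_def[abs_def])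
  have G1: "G 1 = Phi m n z * V" by (simp add: G_def F0_def act)
  have "?z0 \<in> orbit m n ?z0" by (simp add: orbit_def)
  then have "\<forall>\<^sub>F t in cofinite. \<exists>z\<in>orbit m n ?z0. rep m n z (G t)"
    unfolding G_def by (intro act_scale_generic[OF m nd sk w F0]) (use rep0 in auto)
  then have "\<forall>\<^sub>F t in cofinite. f (Psi m n (G t)) = 0"
    by eventually_elim (use f(2) in \<open>auto simp: rep_Psi\<close>)
  \<comment> \<open>The value t = 1 may itself be one of the finitely many exceptions, so the target
    is approached by a limit.\<close>
  then have "\<forall>\<^sub>F t in at 1. f (Psi m n (G t)) = 0" by (rule eventually_at_cofinite)
  then have lim0: "((\<lambda>t. f (Psi m n (G t))) \<longlongrightarrow> 0) (at 1)"
    by (rule tendsto_eventually)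
  have "((\<lambda>t. Psi m n (G t) i j) \<longlongrightarrow> Psi m n (G 1) i j) (at 1)" for i j
  proof (cases "1 \<le> i \<and> i \<le> m \<and> i \<le> j \<and> j \<le> n")
    case True
    \<comment> \<open>The denominators of \<open>Psi\<close> do not vanish at t = 1, since the
      target is a point of the torus.\<close>
    have "solid (G 1) i (j - i) = solid (Phi m n z) i (j - i)"
      unfolding G1 by (rule rep_rmin[OF rep1]) (use True in auto)
    then have "solid (G 1) i (j - i) \<noteq> 0"
      using solid_Phi_nonzero[OF zG, of i "j - i"] True by auto
    moreover have "((\<lambda>t. solid (G t) q s) \<longlongrightarrow> solid (G 1) q s) (at 1)" if "q + s \<le> n" for q s
      by (rule polynomial_family_tendsto, rule polynomial_mat_rmin[OF G]) (use that in auto)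
    ultimately show ?thesis
      using True by (auto simp: Psi_solid intro!: tendsto_divide)
  next
    case False
    then show ?thesis by (auto simp: Psi_def)
  qed
  then have "((\<lambda>t. f (Psi m n (G t))) \<longlongrightarrow> f (Psi m n (G 1))) (at 1)"
    by (rule poly_fun_tendsto[OF f(1)])
  then have "f (Psi m n (G 1)) = 0"
    using lim0 by (rule tendsto_unique[OF at_neq_bot])
  then show "f z = 0" by (simp add: G1 rep_Psi[OF rep1])
qed

theorem theorem5p6:
  fixes m n :: nat and \<omega> :: "nat \<Rightarrow> complex"
  assumes "1 \<le> n"
    and "\<forall>k \<in> {1..min m n}. \<omega> k \<noteq> 0"
  shows "\<exists>z0 \<in> GT_shape m n \<omega>. zariski_dense_in (orbit m n z0) (GT_shape m n \<omega>)"
proof (cases "m = 0")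
  case True
  let ?z0 = "const_pattern m n \<omega>"
  \<comment> \<open>For m = 0 the torus is the single zero array.\<close>
  have sub: "GT_shape m n \<omega> \<subseteq> {?z0}"
    using True by (auto simp: GT_shape_def GT_def const_pattern_def fun_eq_iff)
  have z0: "?z0 \<in> GT_shape m n \<omega>" by (rule const_pattern_shape[OF assms(2)])
  have "?z0 \<in> orbit m n ?z0" by (simp add: orbit_def)
  then have "zariski_dense_in (orbit m n ?z0) (GT_shape m n \<omega>)"
    unfolding zariski_dense_in_def using sub orbit_subset_shape[OF z0] by blast
  then show ?thesis using z0 by blast
next
  case False
  then have "zariski_dense_in (orbit m n (const_pattern m n \<omega>)) (GT_shape m n \<omega>)"
    by (intro orbit_const_pattern_dense[OF _ assms(2)]) simp
  then show ?thesis using const_pattern_shape[OF assms(2)] by blast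
qed

end
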